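(* For every integer $m\ge 2$ and every edge-ordered path $P_4^{\prec}\in\{P_4^{\prec_1},P_4^{\prec_2},P_4^{\prec_3}\}$, $$\hat r_{\mathrm{edge}}(mK_2^{\prec},P_4^{\prec})=3m .$$
   Context: All graphs are finite, simple and undirected. An edge-ordered graph $G^{\prec}$ is a pair $(G,\prec)$ of a graph $G$ and a linear order $\prec$ on $E(G)$. $G^{\prec}$ is an edge-ordered subgraph of $H^{\prec}$ if $G$ is a subgraph of $H$ and the edge order of $G$ is the restriction of the edge order of $H$. Two edge-ordered graphs are isomorphic if there is a graph isomorphism whose induced map on edges preserves the edge orders. An edge-ordered copy of $G^{\prec}$ in $F^{\prec}$ is an edge-ordered subgraph of $F^{\prec}$ isomorphic to $G^{\prec}$. For edge-ordered graphs $G^{\prec},H^{\prec}$, the size edge-ordered Ramsey number $\hat r_{\mathrm{edge}}(G^{\prec},H^{\prec})$ is the minimum number $N$ such that there exists an edge-ordered graph $F^{\prec}$ with $N$ edges such that every red/blue coloring of the edges of $F^{\prec}$ contains a red edge-ordered copy of $G^{\prec}$ or a blue edge-ordered copy of $H^{\prec}$. $mK_2^{\prec}$ is a matching with $m$ edges equipped with a linear order on its edges (all such orders give isomorphic edge-ordered graphs). $P_4^{\prec_1},P_4^{\prec_2},P_4^{\prec_3}$ are the edge-ordered paths on vertices $v_1,v_2,v_3,v_4$ with edges $e_i=v_iv_{i+1}$ ($1\le i\le 3$) and edge orders $P_4^{\prec_1}: e_1\prec e_2\prec e_3$; $P_4^{\prec_2}: e_1\prec e_3\prec e_2$; $P_4^{\prec_3}: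 e_2\prec e_1\prec e_3$. *)

theory Defs
  imports Main
begin

record 'a eo_graph =
  verts :: "'a set"
  edges :: "'a set set"
  eord  :: "'a set rel"

text \<open>As usual for \<^const>\<open>linear_order_on\<close>, the edge order is given by its reflexive version.\<close>

definition edge_ordered_graph :: "'a eo_graph \<Rightarrow> bool" where
  "edge_ordered_graph G \<longleftrightarrow>
     finite (verts G) \<and>
     (\<forall>e\<in>edges G. e \<subseteq> verts G \<and> card e = 2) \<and>
     linear_order_on (edges G) (eord G)"

definition eo_subgraph :: "'a eo_graph \<Rightarrow> 'a eo_graph \<Rightarrow> bool" where
  "eo_subgraph G H \<longleftrightarrow>
     edge_ordered_graph G \<and> edge_ordered_graph H \<and>
     verts G \<subseteq> verts H \<and> edges G \<subseteq> edges H \<and>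
     eord G = Restr (eord H) (edges G)"

definition eo_isomorphic :: "'a eo_graph \<Rightarrow> 'b eo_graph \<Rightarrow> bool" where
  "eo_isomorphic G H \<longleftrightarrow> (\<exists>f.
     bij_betw f (verts G) (verts H) \<and>
     (\<forall>u\<in>verts G. \<forall>v\<in>verts G. {u, v} \<in> edges G \<longleftrightarrow> {f u, f v} \<in> edges H) \<and>
     (\<forall>d\<in>edges G. \<forall>e\<in>edges G. (d, e) \<in> eord G \<longleftrightarrow> (f ` d, f ` e) \<in> eord H))"

text \<open>\<open>C\<close> is an edge-ordered copy of \<open>G\<close> in \<open>F\<close>.\<close>

definition eo_copy :: "'b eo_graph \<Rightarrow> 'a eo_graph \<Rightarrow> 'b eo_graph \<Rightarrow> bool" where
  "eo_copy C G F \<longleftrightarrow> eo_subgraph C F \<and> eo_isomorphic C G"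

datatype color = Red | Blue

text \<open>Colorings are total functions; only their values on \<open>edges F\<close> matter.\<close>

definition eo_arrows :: "'c eo_graph \<Rightarrow> 'a eo_graph \<Rightarrow> 'b eo_graph \<Rightarrow> bool" where
  "eo_arrows F G H \<longleftrightarrow> (\<forall>c :: 'c set \<Rightarrow> color.
     (\<exists>C. eo_copy C G F \<and> (\<forall>e\<in>edges C. c e = Red)) \<or>
     (\<exists>C. eo_copy C H F \<and> (\<forall>e\<in>edges C. c e = Blue)))"

text \<open>Every finite graph is isomorphic to one with vertices in \<^typ>\<open>nat\<close>, so restricting
  the host graphs to this type loses nothing. On \<^typ>\<open>nat\<close>, the infimum of a nonempty set is
  its minimum, and the infimum of the empty set is \<open>0\<close>; so a positive value of
  \<open>size_eo_ramsey\<close> is always attained by some host graph.\<close>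

definition size_eo_ramsey :: "'a eo_graph \<Rightarrow> 'b eo_graph \<Rightarrow> nat" where
  "size_eo_ramsey G H =
     Inf {card (edges F) | F :: nat eo_graph. edge_ordered_graph F \<and> eo_arrows F G H}"

text \<open>\<open>G\<close> is the matching $mK_2$ with an arbitrary linear order on its edges.\<close>

definition is_mK2 :: "nat \<Rightarrow> 'a eo_graph \<Rightarrow> bool" where
  "is_mK2 m G \<longleftrightarrow>
     edge_ordered_graph G \<and> card (edges G) = m \<and>
     pairwise disjnt (edges G) \<and> verts G = \<Union>(edges G)"

text \<open>The linear order that lists the elements of a duplicate-free list increasingly.\<close>

definition list_order :: "'a list \<Rightarrow> 'a rel" where
  "list_order xs = {(xs ! i, xs ! j) | i j. i \<le> j \<and> j < length xs}"

text \<open>The path on the vertices $1, 2, 3, 4$; its edge $e_i$ joins $i$ and $i + 1$, and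
  the argument lists the three edges in increasing order.\<close>

definition P4_edge :: "nat \<Rightarrow> nat set" where
  "P4_edge i = {i, i + 1}"

definition P4 :: "nat set list \<Rightarrow> nat eo_graph" where
  "P4 es = \<lparr>verts = {1, 2, 3, 4}, edges = {P4_edge 1, P4_edge 2, P4_edge 3}, eord = list_order es\<rparr>"

definition P4_1 :: "nat eo_graph" where
  "P4_1 = P4 [P4_edge 1, P4_edge 2, P4_edge 3]"

definition P4_2 :: "nat eo_graph" where
  "P4_2 = P4 [P4_edge 1, P4_edge 3, P4_edge 2]"

definition P4_3 :: "nat eo_graph" where
  "P4_3 = P4 [P4_edge 2, P4_edge 1, P4_edge 3]"

end

theory Submission
  imports Defs "HOL-Library.Nat_Bijection" "HOL-Library.Disjoint_Sets"
begin

text \<open>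
  The upper bound comes from \<open>m\<close> vertex-disjoint copies of \<open>P\<^sub>4\<close>, which have \<open>3 * m\<close> edges. If no
  copy is entirely blue, then each contains a red edge, and these red edges form a matching of
  size \<open>m\<close>. This is \<open>P4_copies_arrows\<close>; it needs that any two ordered matchings of the same size
  are isomorphic (\<open>matchings_isomorphic\<close>).

  For the lower bound, every edge-ordered graph \<open>F\<close> has a set \<open>X\<close> of at most \<open>card (edges F) div 3\<close>
  vertices whose deletion destroys all copies of the edge-ordered \<open>P\<^sub>4\<close> (\<open>path_transversal\<close>). Color
  the edges that meet \<open>X\<close> red and the others blue. Then there is no blue copy of \<open>P\<^sub>4\<close>, and a red
  matching has at most \<open>card X\<close> edges, because its edges meet \<open>X\<close> in distinct vertices. So if
  \<open>F\<close> has the Ramsey property, then \<open>m \<le> card X\<close> and hence \<open>3 * m \<le> card (edges F)\<close>.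

  Without the edge order, a cycle of length five would defeat the transversal: it has five edges,
  but deleting one vertex leaves a path with three edges. In an edge-ordered \<open>P\<^sub>4\<close>, however, the
  middle edge is either above or below the first one. In the first case the least edge of \<open>F\<close>, and
  in the second case the greatest, is never the middle edge of a copy. Therefore the three
  consecutive edges of a cycle that are centred at this extreme edge may survive. One argument
  covers all orders on \<open>P\<^sub>4\<close>, since each of them falls under one of the two cases.
\<close>

section \<open>Finite linear orders\<close>

text \<open>Counting the elements strictly below each element turns a finite linear order into the
  usual order on an initial segment of \<^typ>\<open>nat\<close>; least elements and order isomorphisms can then
  be read off from the natural numbers.\<close>

lemma finite_linear_order_rank:
  assumes fin: "finite A" and lin: "linear_order_on A r"
  obtains \<rho> where "bij_betw \<rho> A {..<card A}"
    and "\<And>d e. d \<in> A \<Longrightarrow> e \<in> A \<Longrightarrow> (d, e) \<in> r \<longleftrightarrow> \<rho> d \<le> \<rho> e"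
proof -
  define below where "below e = {x \<in> A. (x, e) \<in> r \<and> x \<noteq> e}" for e
  have refl: "(e, e) \<in> r" if "e \<in> A" for e
    using lin that by (simp add: order_on_defs refl_on_def)
  have trans: "trans r" and antisym: "antisym r" and total: "total_on A r"
    using lin by (simp_all add: order_on_defs)
  have mono: "card (below d) < card (below e)" if "(d, e) \<in> r" "d \<noteq> e" "d \<in> A" for d e
  proof (rule psubset_card_mono)
    show "finite (below e)" using fin by (simp add: below_def)
    have "below d \<subseteq> below e"
      using that transD[OF trans] antisymD[OF antisym] by (auto simp: below_def)
    moreover have "d \<in> below e" "d \<notin> below d" using that by (simp_all add: below_def)
    ultimately show "below d \<subset> below e" by blast
  qed
  have iff: "(d, e) \<in> r \<longleftrightarrow> card (below d) \<le> card (below e)" if "d \<in> A" "e \<in> A" for d e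
  proof (cases "d = e")
    case True
    then show ?thesis using refl that by simp
  next
    case False
    then show ?thesis
      using mono[of d e] mono[of e d] total that antisymD[OF antisym, of d e]
      by (force simp: total_on_def)
  qed
  have "inj_on (\<lambda>e. card (below e)) A"
    using iff antisymD[OF antisym] by (intro inj_onI) (metis order_refl)
  moreover have "(\<lambda>e. card (below e)) ` A \<subseteq> {..<card A}"
    using fin by (force simp: below_def intro!: psubset_card_mono)
  ultimately have "bij_betw (\<lambda>e. card (below e)) A {..<card A}"
    by (simp add: bij_betw_def card_image card_subset_eq)
  then show thesis using iff by (rule that)
qed

lemma finite_linear_orders_isomorphic:
  assumes "finite A" "finite B" "card A = card B" "linear_order_on A r" "linear_order_on B s"
  obtains \<phi> where "bij_betw \<phi> A B"
    and "\<And>d e. d \<in> A \<Longrightarrow> e \<in> A \<Longrightarrow> (d, e) \<in> r \<longleftrightarrow> (\<phi> d, \<phi> e) \<in> s"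
proof -
  obtain \<rho> where \<rho>: "bij_betw \<rho> A {..<card A}"
    "\<And>d e. d \<in> A \<Longrightarrow> e \<in> A \<Longrightarrow> (d, e) \<in> r \<longleftrightarrow> \<rho> d \<le> \<rho> e"
    using finite_linear_order_rank assms(1,4) by blast
  obtain \<sigma> where \<sigma>: "bij_betw \<sigma> B {..<card A}"
    "\<And>d e. d \<in> B \<Longrightarrow> e \<in> B \<Longrightarrow> (d, e) \<in> s \<longleftrightarrow> \<sigma> d \<le> \<sigma> e"
    using finite_linear_order_rank assms(2,3,5) by metis
  define \<phi> where "\<phi> = inv_into B \<sigma> \<circ> \<rho>"
  have bij: "bij_betw \<phi> A B"
    unfolding \<phi>_def using \<rho>(1) bij_betw_inv_into[OF \<sigma>(1)] by (rule bij_betw_trans)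
  have "\<sigma> (\<phi> e) = \<rho> e" if "e \<in> A" for e
    using bij_betw_inv_into_right[OF \<sigma>(1)] bij_betwE[OF \<rho>(1)] that by (simp add: \<phi>_def)
  then have "(d, e) \<in> r \<longleftrightarrow> (\<phi> d, \<phi> e) \<in> s" if "d \<in> A" "e \<in> A" for d e
    using \<rho>(2) \<sigma>(2) bij_betwE[OF bij] that by simp
  with bij show thesis by (rule that)
qed

lemma finite_linear_order_least:
  assumes "finite A" "linear_order_on A r" "B \<subseteq> A" "B \<noteq> {}"
  shows "\<exists>f\<in>B. \<forall>d\<in>B. d \<noteq> f \<longrightarrow> (d, f) \<notin> r"
proof -
  obtain \<rho> :: "'a \<Rightarrow> nat" where \<rho>: "bij_betw \<rho> A {..<card A}"
    "\<And>d e. d \<in> A \<Longrightarrow> e \<in> A \<Longrightarrow> (d, e) \<in> r \<longleftrightarrow> \<rho> d \<le> \<rho> e"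
    using finite_linear_order_rank assms(1,2) by blast
  obtain f where f: "f \<in> B" "\<And>d. d \<in> B \<Longrightarrow> \<rho> f \<le> \<rho> d"
    using assms(4) ex_has_least_nat[of "\<lambda>x. x \<in> B" _ \<rho>] by blast
  have "(d, f) \<notin> r" if "d \<in> B" "d \<noteq> f" for d
  proof
    assume "(d, f) \<in> r"
    then have "\<rho> d = \<rho> f" using \<rho>(2) f that assms(3) by (metis le_antisym subsetD)
    then show False
      using \<rho>(1) f(1) that assms(3) by (metis bij_betw_imp_inj_on inj_onD subsetD)
  qed
  with f(1) show ?thesis by blast
qed

lemma linear_order_on_Restr_subset:
  assumes "linear_order_on A r" "B \<subseteq> A"
  shows "linear_order_on B (Restr r B)"
  unfolding order_on_defs
proof (intro conjI)
  show "refl_on B (Restr r B)"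
    using assms by (auto simp: order_on_defs refl_on_def)
  have "total_on A r" using assms(1) by (simp add: order_on_defs)
  then show "total_on B (Restr r B)"
    using assms(2) unfolding total_on_def by blast
  show "trans (Restr r B)"
    using assms(1) by (auto simp: order_on_defs intro!: transI dest: transD)
  show "antisym (Restr r B)"
    using assms(1) by (auto simp: order_on_defs intro!: antisymI dest: antisymD)
qed blast

lemma linear_order_on_list_order:
  assumes "distinct xs"
  shows "linear_order_on (set xs) (list_order xs)"
  unfolding order_on_defs
proof (intro conjI)
  show "list_order xs \<subseteq> set xs \<times> set xs" by (auto simp: list_order_def)
  show "refl_on (set xs) (list_order xs)"
    by (fastforce simp: list_order_def refl_on_def in_set_conv_nth)
  show "trans (list_order xs)"
    using assms by (auto simp: list_order_def nth_eq_iff_index_eq trans_def) (metis le_trans)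
  show "antisym (list_order xs)"
    using assms by (auto simp: list_order_def nth_eq_iff_index_eq intro!: antisymI)
  show "total_on (set xs) (list_order xs)"
    unfolding total_on_def
  proof (intro ballI impI)
    fix x y assume "x \<in> set xs" "y \<in> set xs"
    then obtain i j where "x = xs ! i" "i < length xs" "y = xs ! j" "j < length xs"
      by (auto simp: in_set_conv_nth)
    then show "(x, y) \<in> list_order xs \<or> (y, x) \<in> list_order xs"
      using nat_le_linear[of i j] by (auto simp: list_order_def)
  qed
qed

text \<open>Without duplicates, the position of an element is determined, so the order can be decided by
  comparing positions.\<close>

lemma list_order_nth_iff:
  assumes "distinct xs" "i < length xs" "j < length xs"
  shows "(xs ! i, xs ! j) \<in> list_order xs \<longleftrightarrow> i \<le> j"
proof
  assume "(xs ! i, xs ! j) \<in> list_order xs"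
  then obtain i' j' where "xs ! i = xs ! i'" "xs ! j = xs ! j'" "i' \<le> j'" "j' < length xs"
    by (auto simp: list_order_def)
  with assms show "i \<le> j" by (simp add: nth_eq_iff_index_eq)
qed (use assms in \<open>auto simp: list_order_def\<close>)

section \<open>Vertex transversals of ordered paths\<close>

text \<open>The relation only constrains the first edge against the middle one. Taking for \<open>R\<close> the edge
  order or its converse, every copy of an edge-ordered \<open>P\<^sub>4\<close> gives such a path, so destroying
  these paths destroys all copies.\<close>

definition has_path :: "'a set rel \<Rightarrow> 'a set set \<Rightarrow> bool" where
  "has_path R E \<longleftrightarrow> (\<exists>p q r s. distinct [p, q, r, s] \<and>
     {p, q} \<in> E \<and> {q, r} \<in> E \<and> {r, s} \<in> E \<and> ({p, q}, {q, r}) \<in> R)"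

definition star :: "'a set set \<Rightarrow> 'a \<Rightarrow> 'a set set" where
  "star E v = {e \<in> E. v \<in> e}"

definition avoiding :: "'a set set \<Rightarrow> 'a set \<Rightarrow> 'a set set" where
  "avoiding E X = {e \<in> E. e \<inter> X = {}}"

lemma no_path_on_three_vertices:
  assumes "\<Union>E \<subseteq> {a, b, c}"
  shows "\<not> has_path R E"
proof
  assume "has_path R E"
  then obtain p q r s where d: "distinct [p, q, r, s]" and "{p, q} \<in> E" "{r, s} \<in> E"
    unfolding has_path_def by blast
  with assms have "{p, q, r, s} \<subseteq> {a, b, c}" by blast
  with d show False by auto
qed

text \<open>A path inside a path with three edges is that path, up to reversal. So its middle edge is
  \<open>ab\<close>, and its first edge is one of the other two.\<close>

lemma no_path_with_bad_middle:
  assumes E: "E \<subseteq> {{z, a}, {a, b}, {b, c}}" and d: "distinct [z, a, b, c]"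
    and Q: "({z, a}, {a, b}) \<notin> R" "({b, c}, {a, b}) \<notin> R"
  shows "\<not> has_path R E"
proof
  assume "has_path R E"
  then obtain p q r s where d': "distinct [p, q, r, s]"
    and pE: "{p, q} \<in> E" "{q, r} \<in> E" "{r, s} \<in> E" and Q': "({p, q}, {q, r}) \<in> R"
    unfolding has_path_def by blast
  have "{p, q} \<inter> {r, s} = {}" "{p, q} \<inter> {q, r} \<noteq> {}" "{q, r} \<inter> {r, s} \<noteq> {}"
    using d' by auto
  moreover have "{p, q} \<in> {{z, a}, {a, b}, {b, c}}" "{q, r} \<in> {{z, a}, {a, b}, {b, c}}"
      "{r, s} \<in> {{z, a}, {a, b}, {b, c}}"
    using pE E by blast+
  moreover have "{p, q} \<noteq> {q, r}" "{q, r} \<noteq> {r, s}" "{p, q} \<noteq> {r, s}"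
    using d' by (auto simp: doubleton_eq_iff)
  moreover have "{z, a} \<inter> {b, c} = {}" using d by auto
  ultimately have "{q, r} = {a, b} \<and>
      ({p, q} = {z, a} \<and> {r, s} = {b, c} \<or> {p, q} = {b, c} \<and> {r, s} = {z, a})"
    unfolding insert_iff by (metis Int_commute empty_iff)
  with Q Q' show False by auto
qed

text \<open>At a vertex of degree at most two, two known neighbours account for all edges. This is how paths and cycles are followed below.\<close>

lemma star_eq_two_edges:
  assumes "finite E" "card (star E v) \<le> 2" "{v, a} \<in> E" "{v, b} \<in> E" "a \<noteq> b"
  shows "star E v = {{v, a}, {v, b}}"
proof -
  have "finite (star E v)" using assms(1) by (simp add: star_def)
  moreover have "{{v, a}, {v, b}} \<subseteq> star E v" using assms by (simp add: star_def)
  moreover have "card {{v, a}, {v, b}} = 2" using assms(5) by (simp add: doubleton_eq_iff)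
  ultimately show ?thesis using assms(2) by (metis card_seteq)
qed

text \<open>
  One vertex can be deleted for every three edges. The induction removes a set of edges \<open>S\<close> that
  is killed by a set \<open>X0\<close> of at most \<open>card S div 3\<close> vertices, in such a way that what survives of \<open>S\<close>
  is cut off from the rest of the graph and contains no path of the required kind.

  A vertex of degree at least three is deleted together with its edges. Otherwise all degrees are
  at most two. Starting at a leaf \<open>v\<close> of a path \<open>v w x y\<dots>\<close>, deleting \<open>x\<close> cuts off the edge \<open>vw\<close> and
  uses up three edges; if the path stops earlier there is nothing to delete. If there is no leaf,
  the graph is a union of cycles. A cycle of length five is the only obstacle: deleting one of its
  vertices leaves a path with three edges, while deleting two is too expensive. Here the order
  helps: an edge \<open>ab\<close> that is minimal for \<open>R\<close> cannot be the middle edge of a path in question, so the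
  three consecutive edges centred at \<open>ab\<close> may be left intact. The same choice works in longer
  cycles, where the two vertices next to these three edges are deleted and six edges are used up.
\<close>

lemma path_transversal:
  assumes "finite E" "\<forall>e\<in>E. card e = 2"
    and "\<And>E'. E' \<subseteq> E \<Longrightarrow> E' \<noteq> {} \<Longrightarrow>
      \<exists>f\<in>E'. \<forall>d\<in>E'. d \<noteq> f \<longrightarrow> (d, f) \<notin> R"
  shows "\<exists>X. finite X \<and> 3 * card X \<le> card E \<and> \<not> has_path R (avoiding E X)"
  using assms
proof (induction E rule: finite_psubset_induct)
  case (psubset E)
  note two = psubset.prems(1) and extremal = psubset.prems(2)
  have fin: "finite E" by (rule psubset.hyps)
  \<comment> \<open>The removed set splits into the surviving edges \<open>T\<close> and the edges \<open>U\<close> that meet \<open>X0\<close>. As all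
    edges at vertices of \<open>T\<close> are removed too, no path leads from \<open>T\<close> to the remaining graph.\<close>
  have cut: ?case
    if S: "T \<union> U \<subseteq> E" "T \<union> U \<noteq> {}"
      and X0: "finite X0" "3 * card X0 \<le> card (T \<union> U)" "\<forall>e\<in>U. e \<inter> X0 \<noteq> {}"
      and closed: "\<forall>v\<in>\<Union>T. star E v \<subseteq> T \<union> U"
      and none: "\<not> has_path R T" for T U X0
  proof -
    define S where "S = T \<union> U"
    note S = S[folded S_def] and X0 = X0[folded S_def] and closed = closed[folded S_def]
    have avoid: "avoiding S X0 \<subseteq> T" using X0(3) by (auto simp: S_def avoiding_def)
    have "\<exists>X. finite X \<and> 3 * card X \<le> card (E - S) \<and> \<not> has_path R (avoiding (E - S) X)"
    proof (rule psubset.IH)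
      show "E - S \<subset> E" using S by blast
      show "\<forall>e\<in>E - S. card e = 2" using two by blast
      show "\<exists>f\<in>E'. \<forall>d\<in>E'. d \<noteq> f \<longrightarrow> (d, f) \<notin> R"
        if "E' \<subseteq> E - S" "E' \<noteq> {}" for E'
        using that by (intro extremal) auto
    qed
    then obtain X where X: "finite X" "3 * card X \<le> card (E - S)"
      "\<not> has_path R (avoiding (E - S) X)" by blast
    have "card (E - S) + card S = card E"
      using S fin by (metis add.commute card_Diff_subset card_mono finite_subset le_add_diff_inverse)
    moreover have "card (X0 \<union> X) \<le> card X0 + card X" by (rule card_Un_le)
    ultimately have "3 * card (X0 \<union> X) \<le> card E" using X X0 by linarith
    moreover have "\<not> has_path R (avoiding E (X0 \<union> X))"
    proof
      assume "has_path R (avoiding E (X0 \<union> X))"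
      then obtain p q r s where d: "distinct [p, q, r, s]"
        and pE: "{p, q} \<in> avoiding E (X0 \<union> X)" "{q, r} \<in> avoiding E (X0 \<union> X)"
          "{r, s} \<in> avoiding E (X0 \<union> X)" and Q: "({p, q}, {q, r}) \<in> R"
        unfolding has_path_def by blast
      have spread: "e \<in> S" if "d \<in> S" "v \<in> d" "v \<in> e"
        "d \<in> avoiding E (X0 \<union> X)" "e \<in> avoiding E (X0 \<union> X)" for d e v
      proof -
        have "d \<in> T" using avoid that by (auto simp: avoiding_def)
        then show "e \<in> S" using closed that by (auto simp: avoiding_def star_def)
      qed
      have all_or_none: "{p, q} \<in> S \<longleftrightarrow> {q, r} \<in> S" "{q, r} \<in> S \<longleftrightarrow> {r, s} \<in> S"
        using spread[OF _ _ _ pE(1,2), of q] spread[OF _ _ _ pE(2,1), of q]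
          spread[OF _ _ _ pE(2,3), of r] spread[OF _ _ _ pE(3,2), of r] by blast+
      have "has_path R T" if "{q, r} \<in> S"
      proof -
        have "{p, q} \<in> T" "{q, r} \<in> T" "{r, s} \<in> T"
          using that all_or_none pE avoid by (auto simp: avoiding_def)
        then show ?thesis unfolding has_path_def using d Q by blast
      qed
      moreover have "has_path R (avoiding (E - S) X)" if "{q, r} \<notin> S"
      proof -
        have "{p, q} \<in> avoiding (E - S) X" "{q, r} \<in> avoiding (E - S) X"
            "{r, s} \<in> avoiding (E - S) X"
          using that all_or_none pE by (auto simp: avoiding_def)
        then show ?thesis unfolding has_path_def using d Q by blast
      qed
      ultimately have "has_path R T \<or> has_path R (avoiding (E - S) X)" by blast
      with none X(3) show False by blast
    qed
    ultimately show ?thesis using X0(1) X(1) by blast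
  qed
  have loopfree: "u \<noteq> v" if "{u, v} \<in> E" for u v
    using two that by fastforce
  have edgeE: "\<exists>u. e = {v, u}" if "e \<in> E" "v \<in> e" for e v
    using two that by (metis card_2_iff doubleton_eq_iff insertE singletonD)
  consider (empty) "E = {}"
    | (big) v where "card (star E v) \<ge> 3"
    | (leaf) v w where "\<forall>v. card (star E v) \<le> 2" "star E v = {{v, w}}"
    | (cyclic) "E \<noteq> {}" "\<forall>v. card (star E v) \<le> 2"
        "\<And>v w. {v, w} \<in> E \<Longrightarrow> \<exists>u. u \<noteq> w \<and> {v, u} \<in> E"
  proof (cases "(\<exists>v. card (star E v) \<ge> 3) \<or> (\<exists>v w. star E v = {{v, w}}) \<or> E = {}")
    case True
    then show ?thesis using that(1,2,3) by (metis not_less_eq_eq numeral_2_eq_2 numeral_3_eq_3)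
  next
    case False
    have "\<exists>u. u \<noteq> w \<and> {v, u} \<in> E" if "{v, w} \<in> E" for v w
    proof -
      have "{v, w} \<in> star E v" using that by (simp add: star_def)
      with False obtain e where "e \<in> star E v" "e \<noteq> {v, w}" by blast
      then show ?thesis using edgeE[of e v] by (auto simp: star_def)
    qed
    with False that(4) show ?thesis by (metis not_less_eq_eq numeral_2_eq_2 numeral_3_eq_3)
  qed
  then show ?case
  proof cases
    case empty
    then show ?thesis by (auto simp: has_path_def avoiding_def intro!: exI[of _ "{}"])
  next
    case big
    have "\<not> has_path R {}" by (simp add: has_path_def)
    moreover have "star E v \<noteq> {}" using big by auto
    ultimately show ?thesis
      by (intro cut[of "{}" "star E v" "{v}"]) (use big in \<open>auto simp: star_def\<close>)
  next
    case leaf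
    note two_edges = star_eq_two_edges[OF fin leaf(1)[rule_format]]
    have vw: "{v, w} \<in> E" using leaf(2) by (auto simp: star_def)
    show ?thesis
    proof (cases "\<exists>x. x \<noteq> v \<and> {w, x} \<in> E")
      case False
      have sw: "star E w = {{v, w}}"
        using False vw edgeE by (fastforce simp: star_def)
      show ?thesis
      proof (rule cut[of "{{v, w}}" "{}" "{}"])
        show "{{v, w}} \<union> {} \<subseteq> E" using vw by simp
        show "3 * card ({} :: 'a set) \<le> card ({{v, w}} \<union> {})" using vw by (simp del: Un_insert_right)
        show "\<forall>u\<in>\<Union>{{v, w}}. star E u \<subseteq> {{v, w}} \<union> {}"
          using leaf(2) sw by (auto simp: doubleton_eq_iff)
        show "\<not> has_path R {{v, w}}"
            by (rule no_path_on_three_vertices[where a=v and b=w and c=w]) simp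
      qed simp_all
    next
      case True
      then obtain x where x: "x \<noteq> v" "{w, x} \<in> E" by blast
      have sw: "star E w = {{w, v}, {w, x}}"
        using two_edges[of w v x] x vw by (simp add: insert_commute)
      show ?thesis
      proof (cases "\<exists>y. y \<noteq> w \<and> {x, y} \<in> E")
        case False
        have sx: "star E x = {{w, x}}"
          using False x edgeE by (fastforce simp: star_def)
        show ?thesis
        proof (rule cut[of "{{v, w}, {w, x}}" "{}" "{}"])
          show "{{v, w}, {w, x}} \<union> {} \<subseteq> E" using vw x(2) by simp
          show "3 * card ({} :: 'a set) \<le> card ({{v, w}, {w, x}} \<union> {})" using vw by (simp del: Un_insert_right)
          show "\<forall>u\<in>\<Union>{{v, w}, {w, x}}. star E u \<subseteq> {{v, w}, {w, x}} \<union> {}"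
            using leaf(2) sw sx by (auto simp: doubleton_eq_iff)
          show "\<not> has_path R {{v, w}, {w, x}}"
            by (rule no_path_on_three_vertices[where a=v and b=w and c=x]) simp
        qed simp_all
      next
        case True
        then obtain y where y: "y \<noteq> w" "{x, y} \<in> E" by blast
        have "y \<noteq> v"
        proof
          assume "y = v"
          then have "{x, v} \<in> star E v" using y by (simp add: star_def)
          then show False using leaf(2) loopfree[OF x(2)] x(1) by (auto simp: doubleton_eq_iff)
        qed
        then have card3: "card {{v, w}, {w, x}, {x, y}} = 3"
          using x y loopfree[OF vw] loopfree[OF x(2)] by (auto simp: card_insert_if doubleton_eq_iff)
        show ?thesis
        proof (rule cut[of "{{v, w}}" "{{w, x}, {x, y}}" "{x}"])
          show "{{v, w}} \<union> {{w, x}, {x, y}} \<subseteq> E" using vw x(2) y(2) by simp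
          show "3 * card {x} \<le> card ({{v, w}} \<union> {{w, x}, {x, y}})" using card3 by (simp del: Un_insert_right)
          show "\<forall>u\<in>\<Union>{{v, w}}. star E u \<subseteq> {{v, w}} \<union> {{w, x}, {x, y}}"
            using leaf(2) sw by (auto simp: doubleton_eq_iff)
          show "\<not> has_path R {{v, w}}"
            by (rule no_path_on_three_vertices[where a=v and b=w and c=w]) simp
        qed simp_all
      qed
    qed
  next
    case cyclic
    note two_edges = star_eq_two_edges[OF fin cyclic(2)[rule_format]]
    \<comment> \<open>Let \<open>z\<close>, \<open>a\<close>, \<open>b\<close>, \<open>c\<close> be consecutive on a cycle with the minimal edge \<open>ab\<close> in the middle, then
      continue to \<open>y\<close> beyond \<open>z\<close> and to \<open>d\<close> beyond \<open>c\<close>.\<close>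
    obtain f where f: "f \<in> E" "\<And>d. d \<in> E \<Longrightarrow> d \<noteq> f \<Longrightarrow> (d, f) \<notin> R"
      using extremal[of E] cyclic(1) by blast
    obtain a b where ab: "f = {a, b}" "a \<noteq> b" using two f(1) by (meson card_2_iff)
    obtain z where z: "z \<noteq> b" "{a, z} \<in> E" using cyclic(3)[of a b] f ab by auto
    obtain c where c: "c \<noteq> a" "{b, c} \<in> E" using cyclic(3)[of b a] f ab by (auto simp: insert_commute)
    have abE: "{a, b} \<in> E" using f ab by simp
    have ne: "z \<noteq> a" "c \<noteq> b" using loopfree z c by blast+
    have sa: "star E a = {{a, b}, {a, z}}" using two_edges[of a b z] abE z by simp
    have sb: "star E b = {{a, b}, {b, c}}"
      using two_edges[of b a c] abE c by (simp add: insert_commute)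
    show ?thesis
    proof (cases "z = c")
      \<comment> \<open>A triangle contains no path with three edges.\<close>
      case True
      have sc: "star E c = {{a, c}, {b, c}}"
        using two_edges[of c a b] z c True ab by (simp add: insert_commute)
      show ?thesis
      proof (rule cut[of "{{a, b}, {b, c}, {a, c}}" "{}" "{}"])
        show "{{a, b}, {b, c}, {a, c}} \<union> {} \<subseteq> E" using abE c(2) z(2) True by simp
        show "3 * card ({} :: 'a set) \<le> card ({{a, b}, {b, c}, {a, c}} \<union> {})" using abE by (simp del: Un_insert_right)
        show "\<forall>u\<in>\<Union>{{a, b}, {b, c}, {a, c}}. star E u \<subseteq> {{a, b}, {b, c}, {a, c}} \<union> {}"
          using sa sb sc True by (auto simp: doubleton_eq_iff)
        show "\<not> has_path R {{a, b}, {b, c}, {a, c}}"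
            by (rule no_path_on_three_vertices[where a=a and b=b and c=c]) simp
      qed simp_all
    next
      case zc: False
      obtain y where y: "y \<noteq> a" "{z, y} \<in> E"
        using cyclic(3)[of z a] z by (auto simp: insert_commute)
      obtain d where d: "d \<noteq> b" "{c, d} \<in> E"
        using cyclic(3)[of c b] c by (auto simp: insert_commute)
      have sz: "star E z = {{a, z}, {z, y}}"
        using two_edges[of z a y] z y by (simp add: insert_commute)
      have sc: "star E c = {{b, c}, {c, d}}"
        using two_edges[of c b d] c d by (simp add: insert_commute)
      have ne': "y \<noteq> z" "d \<noteq> c" using loopfree y d by blast+
      have yb: "y \<noteq> b"
      proof
        assume "y = b"
        then have "{z, b} \<in> star E b" using y by (simp add: star_def)
        then show False using sb z zc ne by (auto simp: doubleton_eq_iff)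
      qed
      have da: "d \<noteq> a"
      proof
        assume "d = a"
        then have "{c, a} \<in> star E a" using d by (simp add: star_def)
        then show False using sa c zc ne by (auto simp: doubleton_eq_iff)
      qed
      note distinct = ab(2) z(1) c(1) ne zc y(1) d(1) ne' yb da
      show ?thesis
      proof (cases "d = z")
        \<comment> \<open>A cycle of length four loses the vertex \<open>z\<close>.\<close>
        case True
        have card4: "card {{a, b}, {b, c}, {c, z}, {a, z}} = 4"
          using distinct by (auto simp: card_insert_if doubleton_eq_iff)
        show ?thesis
        proof (rule cut[of "{{a, b}, {b, c}}" "{{c, z}, {a, z}}" "{z}"])
          show "{{a, b}, {b, c}} \<union> {{c, z}, {a, z}} \<subseteq> E" using abE c(2) d(2) z(2) True by simp
          show "3 * card {z} \<le> card ({{a, b}, {b, c}} \<union> {{c, z}, {a, z}})" using card4 by (simp del: Un_insert_right)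
          show "\<forall>u\<in>\<Union>{{a, b}, {b, c}}. star E u \<subseteq> {{a, b}, {b, c}} \<union> {{c, z}, {a, z}}"
            using sa sb sc True by (auto simp: doubleton_eq_iff)
          show "\<not> has_path R {{a, b}, {b, c}}"
            by (rule no_path_on_three_vertices[where a=a and b=b and c=c]) simp
        qed simp_all
      next
        case dz: False
        have yc: "y \<noteq> c"
        proof
          assume "y = c"
          then have "{z, c} \<in> star E c" using y by (simp add: star_def)
          then show False using sc dz distinct by (auto simp: doubleton_eq_iff)
        qed
        have "{z, a} \<in> E" using z by (simp add: insert_commute)
        then have "({z, a}, {a, b}) \<notin> R" "({b, c}, {a, b}) \<notin> R"
          using f(2)[of "{z, a}"] f(2)[of "{b, c}"] c distinct
          unfolding ab(1) by (auto simp: doubleton_eq_iff)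
        then have bad: "\<not> has_path R T" if "T \<subseteq> {{z, a}, {a, b}, {b, c}}" for T
          using no_path_with_bad_middle[OF that] distinct by auto
        show ?thesis
        proof (cases "y = d")
          \<comment> \<open>In a cycle of length five, \<open>y\<close> is the vertex opposite to \<open>ab\<close>.\<close>
          case True
          have card5: "card {{z, a}, {a, b}, {b, c}, {c, y}, {z, y}} = 5"
            using distinct yc dz by (auto simp: card_insert_if doubleton_eq_iff)
          show ?thesis
          proof (rule cut[of "{{z, a}, {a, b}, {b, c}}" "{{c, y}, {z, y}}" "{y}"])
            show "{{z, a}, {a, b}, {b, c}} \<union> {{c, y}, {z, y}} \<subseteq> E" using abE c(2) d(2) y(2) True \<open>{z, a} \<in> E\<close> by simp
            show "3 * card {y} \<le> card ({{z, a}, {a, b}, {b, c}} \<union> {{c, y}, {z, y}})" using card5 by (simp del: Un_insert_right)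
            show "\<forall>u\<in>\<Union>{{z, a}, {a, b}, {b, c}}. star E u \<subseteq> {{z, a}, {a, b}, {b, c}} \<union> {{c, y}, {z, y}}"
              using sa sb sc sz True by (auto simp: doubleton_eq_iff)
            show "\<not> has_path R {{z, a}, {a, b}, {b, c}}" by (rule bad) simp
          qed simp_all
        next
          \<comment> \<open>The sixth edge is the second one at \<open>y\<close>. It differs from \<open>cd\<close> even if the cycle has
            length six, where \<open>x = d\<close>.\<close>
          case False
          obtain x where x: "x \<noteq> z" "{y, x} \<in> E"
            using cyclic(3)[of y z] y by (auto simp: insert_commute)
          have "x \<noteq> y" using loopfree x by blast
          have "{y, x} \<notin> star E a" "{y, x} \<notin> star E b" "{y, x} \<notin> star E c"
            unfolding sa sb sc using distinct yc False by (auto simp: doubleton_eq_iff)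
          then have "x \<noteq> a" "x \<noteq> b" "x \<noteq> c" using x by (auto simp: star_def)
          then have card6: "card {{z, a}, {a, b}, {b, c}, {c, d}, {z, y}, {y, x}} = 6"
            using distinct yc dz False x \<open>x \<noteq> y\<close> by (auto simp: card_insert_if doubleton_eq_iff)
          show ?thesis
          proof (rule cut[of "{{z, a}, {a, b}, {b, c}}" "{{c, d}, {z, y}, {y, x}}" "{y, d}"])
            show "{{z, a}, {a, b}, {b, c}} \<union> {{c, d}, {z, y}, {y, x}} \<subseteq> E" using abE c(2) d(2) y(2) x(2) \<open>{z, a} \<in> E\<close> by simp
            show "3 * card {y, d} \<le> card ({{z, a}, {a, b}, {b, c}} \<union> {{c, d}, {z, y}, {y, x}})" using card6 False by (simp del: Un_insert_right)
            show "\<forall>u\<in>\<Union>{{z, a}, {a, b}, {b, c}}. star E u \<subseteq> {{z, a}, {a, b}, {b, c}} \<union> {{c, d}, {z, y}, {y, x}}"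
              using sa sb sc sz by (auto simp: doubleton_eq_iff)
            show "\<not> has_path R {{z, a}, {a, b}, {b, c}}" by (rule bad) simp
          qed simp_all
        qed
      qed
    qed
  qed
qed

section \<open>Copies of matchings and paths\<close>

lemma eo_subgraph_induced:
  assumes "edge_ordered_graph F" "E \<subseteq> edges F" "V = \<Union>E"
  shows "eo_subgraph \<lparr>verts = V, edges = E, eord = Restr (eord F) E\<rparr> F"
proof -
  have "\<Union>E \<subseteq> verts F" using assms unfolding edge_ordered_graph_def by blast
  moreover have "finite (\<Union>E)"
    using calculation assms unfolding edge_ordered_graph_def by (metis finite_subset)
  ultimately show ?thesis
    using assms linear_order_on_Restr_subset[of "edges F" "eord F" E]
    unfolding eo_subgraph_def edge_ordered_graph_def by auto
qed

lemma edge_bij_of_vertex_bij: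
  assumes "edge_ordered_graph G" "edge_ordered_graph H" and f: "bij_betw f (verts G) (verts H)"
    and adj: "\<forall>u\<in>verts G. \<forall>v\<in>verts G. {u, v} \<in> edges G \<longleftrightarrow> {f u, f v} \<in> edges H"
  shows "bij_betw ((`) f) (edges G) (edges H)"
proof (rule bij_betw_imageI)
  have inG: "e \<subseteq> verts G" "card e = 2" if "e \<in> edges G" for e
    using assms(1) that by (auto simp: edge_ordered_graph_def)
  have inH: "e \<subseteq> verts H" "card e = 2" if "e \<in> edges H" for e
    using assms(2) that by (auto simp: edge_ordered_graph_def)
  have "inj_on f (\<Union>(edges G))"
    using f inG(1) by (meson Sup_least bij_betw_imp_inj_on inj_on_subset)
  then show "inj_on ((`) f) (edges G)" by (rule inj_on_image)
  show "(`) f ` edges G = edges H"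
  proof (intro equalityI subsetI)
    fix h assume "h \<in> (`) f ` edges G"
    then obtain e where e: "e \<in> edges G" "h = f ` e" by blast
    then obtain u v where "e = {u, v}" using inG by (meson card_2_iff)
    then show "h \<in> edges H" using e adj inG(1)[of e] by simp
  next
    fix h assume h: "h \<in> edges H"
    then obtain x y where xy: "h = {x, y}" using inH by (meson card_2_iff)
    have "x \<in> f ` verts G" "y \<in> f ` verts G"
      using inH(1)[OF h] xy by (simp_all add: bij_betw_imp_surj_on[OF f])
    then obtain u v where "u \<in> verts G" "v \<in> verts G" "x = f u" "y = f v"
      by (elim imageE)
    then show "h \<in> (`) f ` edges G" using adj h xy by (intro image_eqI[of _ _ "{u, v}"]) auto
  qed
qed

text \<open>The order isomorphism between the two edge sets prescribes which edge goes to which. As the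
  edges are disjoint, any choice of bijections between corresponding edges glues to a bijection
  of the vertices.\<close>

lemma matchings_isomorphic:
  assumes "is_mK2 m G" "is_mK2 m H"
  shows "eo_isomorphic G H"
proof -
  have G: "edge_ordered_graph G" "card (edges G) = m" "pairwise disjnt (edges G)" "verts G = \<Union>(edges G)"
    and H: "edge_ordered_graph H" "card (edges H) = m" "pairwise disjnt (edges H)" "verts H = \<Union>(edges H)"
    using assms by (auto simp: is_mK2_def)
  have two: "\<And>e. e \<in> edges G \<Longrightarrow> card e = 2" "\<And>e. e \<in> edges H \<Longrightarrow> card e = 2"
    and fin: "finite (edges G)" "finite (edges H)"
    and lin: "linear_order_on (edges G) (eord G)" "linear_order_on (edges H) (eord H)"
    using G(1,4) H(1,4) by (auto simp: edge_ordered_graph_def intro: finite_UnionD)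
  obtain \<phi> where \<phi>: "bij_betw \<phi> (edges G) (edges H)"
    "\<And>d e. d \<in> edges G \<Longrightarrow> e \<in> edges G \<Longrightarrow> (d, e) \<in> eord G \<longleftrightarrow> (\<phi> d, \<phi> e) \<in> eord H"
    using finite_linear_orders_isomorphic[OF fin _ lin] G(2) H(2) by metis
  have "\<exists>g. bij_betw g e (\<phi> e)" if "e \<in> edges G" for e
    using two(1)[OF that] two(2)[of "\<phi> e"] bij_betwE[OF \<phi>(1)] that
    by (intro finite_same_card_bij) (auto intro: card_ge_0_finite)
  then obtain g where g: "\<And>e. e \<in> edges G \<Longrightarrow> bij_betw (g e) e (\<phi> e)" by metis
  \<comment> \<open>Every vertex lies in exactly one edge, which selects the local bijection to apply.\<close>
  define f where "f v = g (THE e. e \<in> edges G \<and> v \<in> e) v" for v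
  have f_eq: "f v = g e v" if "e \<in> edges G" "v \<in> e" for e v
  proof -
    have "(THE e. e \<in> edges G \<and> v \<in> e) = e"
      using that G(3) by (intro the_equality) (auto simp: pairwise_def disjnt_def)
    then show ?thesis by (simp add: f_def)
  qed
  have bij_e: "bij_betw f e (\<phi> e)" if "e \<in> edges G" for e
    using g[OF that] f_eq[OF that] bij_betw_cong[of e f "g e" "\<phi> e"] by blast
  then have f_img: "f ` e = \<phi> e" if "e \<in> edges G" for e
    using that by (simp add: bij_betw_def)
  have "bij_betw f (\<Union>e\<in>edges G. e) (\<Union>e\<in>edges G. \<phi> e)"
  proof (rule bij_betw_UNION_disjoint)
    show "disjoint_family_on \<phi> (edges G)"
      unfolding disjoint_family_on_def
    proof (intro ballI impI)
      fix d e assume "d \<in> edges G" "e \<in> edges G" "d \<noteq> e"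
      then have "\<phi> d \<in> edges H" "\<phi> e \<in> edges H" "\<phi> d \<noteq> \<phi> e"
        using \<phi>(1) by (auto simp: bij_betw_def inj_on_eq_iff)
      then show "\<phi> d \<inter> \<phi> e = {}" using H(3) by (simp add: pairwise_def disjnt_def)
    qed
  qed (rule bij_e)
  then have bij: "bij_betw f (verts G) (verts H)"
    using G(4) H(4) \<phi>(1) by (simp add: bij_betw_def)
  have "{u, v} \<in> edges G \<longleftrightarrow> {f u, f v} \<in> edges H" if uv: "u \<in> verts G" "v \<in> verts G" for u v
  proof
    assume "{u, v} \<in> edges G"
    then show "{f u, f v} \<in> edges H" using f_img[of "{u, v}"] bij_betwE[OF \<phi>(1)] by fastforce
  next
    assume "{f u, f v} \<in> edges H"
    then obtain e where e: "e \<in> edges G" "f ` {u, v} = f ` e"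
      using \<phi>(1) f_img unfolding bij_betw_def by (smt (verit, best) image_empty image_iff image_insert)
    have "{u, v} = e"
      using inj_on_image_eq_iff[OF bij_betw_imp_inj_on[OF bij]] e uv G(4) by (metis Union_upper empty_subsetI insert_subset)
    with e show "{u, v} \<in> edges G" by simp
  qed
  then show ?thesis
    unfolding eo_isomorphic_def using bij \<phi>(2) f_img by (intro exI[of _ f]) simp
qed

text \<open>Isomorphism invariance of being a matching of a given size: a red copy of $mK_2$ is itself
  a set of \<open>m\<close> disjoint edges.\<close>

lemma matching_of_isomorphic:
  assumes "is_mK2 m G" "edge_ordered_graph C" "eo_isomorphic C G"
  shows "card (edges C) = m" "pairwise disjnt (edges C)"
proof -
  obtain f where f: "bij_betw f (verts C) (verts G)"
    "\<forall>u\<in>verts C. \<forall>v\<in>verts C. {u, v} \<in> edges C \<longleftrightarrow> {f u, f v} \<in> edges G"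
    using assms(3) by (auto simp: eo_isomorphic_def)
  have bij: "bij_betw ((`) f) (edges C) (edges G)"
    using edge_bij_of_vertex_bij[OF assms(2) _ f] assms(1) by (simp add: is_mK2_def)
  then show "card (edges C) = m"
    using assms(1) by (simp add: is_mK2_def bij_betw_same_card)
  show "pairwise disjnt (edges C)"
  proof (rule pairwiseI)
    fix d e assume de: "d \<in> edges C" "e \<in> edges C" "d \<noteq> e"
    then have "f ` d \<in> edges G" "f ` e \<in> edges G" "f ` d \<noteq> f ` e"
      using bij by (auto simp: bij_betw_def inj_on_def)
    then have "disjnt (f ` d) (f ` e)" using assms(1) by (auto simp: is_mK2_def pairwise_def)
    then show "disjnt d e" by (auto simp: disjnt_def)
  qed
qed

lemma card_matching_le_transversal:
  assumes "finite X" "pairwise disjnt M" "\<forall>e\<in>M. e \<inter> X \<noteq> {}"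
  shows "card M \<le> card X"
proof -
  obtain x where x: "\<And>e. e \<in> M \<Longrightarrow> x e \<in> e \<inter> X"
  proof -
    have "\<forall>e\<in>M. \<exists>x. x \<in> e \<inter> X" using assms(3) by blast
    then show thesis using that by (metis bchoice)
  qed
  have "inj_on x M"
    using x assms(2) by (intro inj_onI) (metis IntD1 disjnt_iff pairwiseD)
  then show ?thesis using x assms(1) by (intro card_inj_on_le[of x]) auto
qed

lemma P4_edges: "P4_edge 1 = {1, 2}" "P4_edge 2 = {2, 3}" "P4_edge 3 = {3, 4}"
  by (simp_all add: P4_edge_def numeral_eq_Suc)

text \<open>The copy is read along the inverse of its isomorphism to the path on $1, 2, 3, 4$.\<close>

lemma P4_copy_path:
  assumes "eo_copy C (P4 es) F"
  obtains p q r s where "distinct [p, q, r, s]"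
    and "{p, q} \<in> edges C" "{q, r} \<in> edges C" "{r, s} \<in> edges C"
    and "(P4_edge 1, P4_edge 2) \<in> list_order es \<Longrightarrow> ({p, q}, {q, r}) \<in> eord F"
    and "(P4_edge 2, P4_edge 1) \<in> list_order es \<Longrightarrow> ({q, r}, {p, q}) \<in> eord F"
proof -
  have C: "eord C = Restr (eord F) (edges C)" "eo_isomorphic C (P4 es)"
    using assms by (auto simp: eo_copy_def eo_subgraph_def)
  obtain f where bij: "bij_betw f (verts C) {1, 2, 3, 4}"
    and adj: "\<And>u v. u \<in> verts C \<Longrightarrow> v \<in> verts C \<Longrightarrow>
      {u, v} \<in> edges C \<longleftrightarrow> {f u, f v} \<in> {P4_edge 1, P4_edge 2, P4_edge 3}"
    and ord: "\<And>d e. d \<in> edges C \<Longrightarrow> e \<in> edges C \<Longrightarrow>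
      (d, e) \<in> eord C \<longleftrightarrow> (f ` d, f ` e) \<in> list_order es"
    using C(2) by (auto simp: eo_isomorphic_def P4_def)
  define g where "g = inv_into (verts C) f"
  have g: "g i \<in> verts C" "f (g i) = i" if "i \<in> {1, 2, 3, 4}" for i
    using bij_betwE[OF bij_betw_inv_into[OF bij]] bij_betw_inv_into_right[OF bij] that
    by (auto simp: g_def)
  have fg: "f (g 1) = 1" "f (g 2) = 2" "f (g 3) = 3" "f (g 4) = 4"
    by (simp_all add: g(2))
  have edges: "{g 1, g 2} \<in> edges C" "{g 2, g 3} \<in> edges C" "{g 3, g 4} \<in> edges C"
    using adj[of "g 1" "g 2"] adj[of "g 2" "g 3"] adj[of "g 3" "g 4"] g(1) fg P4_edges by simp_all
  have "f ` {g 1, g 2} = P4_edge 1" "f ` {g 2, g 3} = P4_edge 2"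
    using fg P4_edges by simp_all
  then have "(P4_edge 1, P4_edge 2) \<in> list_order es \<Longrightarrow> ({g 1, g 2}, {g 2, g 3}) \<in> eord F"
    "(P4_edge 2, P4_edge 1) \<in> list_order es \<Longrightarrow> ({g 2, g 3}, {g 1, g 2}) \<in> eord F"
    using ord[OF edges(1,2)] ord[OF edges(2,1)] C(1) by simp_all
  moreover have "distinct (map f [g 1, g 2, g 3, g 4])"
    unfolding list.map fg by simp
  then have "distinct [g 1, g 2, g 3, g 4]" unfolding distinct_map by blast
  ultimately show thesis using edges by (rule that[rotated 4])
qed

section \<open>Disjoint copies of the path\<close>

text \<open>Copy \<open>k\<close> of the path has the vertices \<open>prod_encode (k, v)\<close> and the edges with the numbers
  \<open>3 * k\<close>, \<open>3 * k + 1\<close>, \<open>3 * k + 2\<close>, in increasing order. Ordering all edges by their number thus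
  puts the copies one after the other and restricts to the right order on each of them.\<close>

definition P4_copies_edge :: "nat set list \<Rightarrow> nat \<Rightarrow> nat set" where
  "P4_copies_edge es n = (\<lambda>v. prod_encode (n div 3, v)) ` (es ! (n mod 3))"

definition P4_copies :: "nat \<Rightarrow> nat set list \<Rightarrow> nat eo_graph" where
  "P4_copies m es = (let L = map (P4_copies_edge es) [0..<3 * m]
     in \<lparr>verts = \<Union>(set L), edges = set L, eord = list_order L\<rparr>)"

context
  fixes es :: "nat set list"
  assumes distinct_es: "distinct es" and set_es: "set es = {P4_edge 1, P4_edge 2, P4_edge 3}"
begin

lemma length_es: "length es = 3"
proof -
  have "card {P4_edge 1, P4_edge 2, P4_edge 3} = 3"
    unfolding P4_edges by (simp add: doubleton_eq_iff)
  then show ?thesis using distinct_card[OF distinct_es] set_es by simp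
qed

lemma P4_list_edge:
  assumes "e \<in> set es"
  shows "e \<subseteq> {1, 2, 3, 4}" "card e = 2"
  using assms unfolding set_es P4_edges by auto

lemma nth_mod_mem: "es ! (n mod 3) \<in> set es"
  by (rule nth_mem) (simp add: length_es)

lemma P4_copies_edge_disjoint:
  assumes "n div 3 \<noteq> n' div 3"
  shows "P4_copies_edge es n \<inter> P4_copies_edge es n' = {}"
  using assms unfolding P4_copies_edge_def by auto

lemma card_P4_copies_edge: "card (P4_copies_edge es n) = 2"
proof -
  have "inj (\<lambda>v. prod_encode (n div 3, v))" by (simp add: inj_on_def)
  then show ?thesis
    unfolding P4_copies_edge_def using P4_list_edge(2)[OF nth_mod_mem[of n]]
    by (metis card_image inj_on_subset subset_UNIV)
qed

lemma inj_P4_copies_edge: "inj (P4_copies_edge es)"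
proof (rule injI)
  fix n n' assume eq: "P4_copies_edge es n = P4_copies_edge es n'"
  have "P4_copies_edge es n \<noteq> {}" using card_P4_copies_edge[of n] by auto
  then have same_div: "n div 3 = n' div 3" using P4_copies_edge_disjoint[of n n'] eq by blast
  have "inj (\<lambda>v. prod_encode (n div 3, v))" by (simp add: inj_on_def)
  then have "es ! (n mod 3) = es ! (n' mod 3)"
    using eq same_div by (simp add: P4_copies_edge_def inj_image_eq_iff)
  then have "n mod 3 = n' mod 3"
    using distinct_es length_es by (simp add: nth_eq_iff_index_eq)
  with same_div show "n = n'" by (metis div_mult_mod_eq)
qed

lemma distinct_P4_copies_edges: "distinct (map (P4_copies_edge es) [0..<3 * m])"
  unfolding distinct_map using inj_on_subset[OF inj_P4_copies_edge subset_UNIV] by simp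

lemma edges_P4_copies: "edges (P4_copies m es) = P4_copies_edge es ` {..<3 * m}"
  by (simp add: P4_copies_def Let_def atLeast0LessThan)

lemma verts_P4_copies: "verts (P4_copies m es) = \<Union>(edges (P4_copies m es))"
  by (simp add: P4_copies_def Let_def)

lemma eord_P4_copies_iff:
  assumes "i < 3 * m" "j < 3 * m"
  shows "(P4_copies_edge es i, P4_copies_edge es j) \<in> eord (P4_copies m es) \<longleftrightarrow> i \<le> j"
proof -
  from list_order_nth_iff[OF distinct_P4_copies_edges, of i m j] show ?thesis
    using assms by (simp add: P4_copies_def Let_def)
qed

lemma edge_ordered_graph_P4_copies: "edge_ordered_graph (P4_copies m es)"
proof -
  from linear_order_on_list_order[OF distinct_P4_copies_edges]
  have "linear_order_on (edges (P4_copies m es)) (eord (P4_copies m es))"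
    by (simp add: P4_copies_def Let_def)
  moreover have "finite (verts (P4_copies m es))"
    unfolding verts_P4_copies edges_P4_copies using card_P4_copies_edge
    by (auto intro!: card_ge_0_finite)
  ultimately show ?thesis
    unfolding edge_ordered_graph_def verts_P4_copies
    using card_P4_copies_edge by (auto simp: edges_P4_copies)
qed

lemma card_edges_P4_copies: "card (edges (P4_copies m es)) = 3 * m"
  using inj_on_subset[OF inj_P4_copies_edge subset_UNIV] by (simp add: edges_P4_copies card_image)

lemma P4_copies_contains_P4:
  assumes "k < m"
  shows "\<exists>C. eo_copy C (P4 es) (P4_copies m es) \<and>
    edges C = P4_copies_edge es ` {3 * k..<3 * k + 3}"
proof -
  let ?F = "P4_copies m es"
  let ?g = "\<lambda>v. prod_encode (k, v)"
  let ?f = "\<lambda>x. snd (prod_decode x)"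
  define E where "E = P4_copies_edge es ` {3 * k..<3 * k + 3}"
  have block: "P4_copies_edge es (3 * k + i) = ?g ` (es ! i)" if "i < 3" for i
    using that by (simp add: P4_copies_edge_def)
  have "{3 * k..<3 * k + 3} = (\<lambda>i. 3 * k + i) ` {..<3}"
    by (metis add.commute add_0 atLeast0LessThan image_add_atLeastLessThan)
  then have "E = (\<lambda>i. ?g ` (es ! i)) ` {..<3}"
    using block by (simp add: E_def image_image)
  also have "\<dots> = (`) ?g ` set es"
  proof -
    have "set es = (\<lambda>i. es ! i) ` {..<3}" by (auto simp: set_conv_nth length_es)
    then show ?thesis by (simp add: image_image)
  qed
  finally have E: "E = (`) ?g ` set es" .
  have inj: "inj ?g" by (simp add: inj_on_def)
  have decode: "?f ` ?g ` e = e" for e by (simp add: image_image)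
  have "\<Union>(set es) = {1, 2, 3, 4}" unfolding set_es P4_edges by auto
  then have V: "?g ` {1, 2, 3, 4} = \<Union>E" unfolding E by (metis image_Union)
  define C where "C = \<lparr>verts = ?g ` {1, 2, 3, 4}, edges = E, eord = Restr (eord ?F) E\<rparr>"
  have "E \<subseteq> edges ?F" unfolding E_def edges_P4_copies using assms by auto
  then have "eo_subgraph C ?F"
    unfolding C_def using edge_ordered_graph_P4_copies V by (intro eo_subgraph_induced)
  moreover have "eo_isomorphic C (P4 es)"
    unfolding eo_isomorphic_def
  proof (intro exI[of _ ?f] conjI ballI)
    show "bij_betw ?f (verts C) (verts (P4 es))"
      by (rule bij_betw_byWitness[of _ ?g]) (auto simp: C_def P4_def)
  next
    fix u v assume "u \<in> verts C" "v \<in> verts C"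
    then obtain a b where ab: "u = ?g a" "v = ?g b" by (auto simp: C_def)
    have "{u, v} \<in> edges C \<longleftrightarrow> ?g ` {a, b} \<in> (`) ?g ` set es" by (simp add: C_def E ab)
    also have "\<dots> \<longleftrightarrow> {a, b} \<in> set es" 
      unfolding image_iff[of "?g ` {a, b}"] inj_image_eq_iff[OF inj] by blast
    finally show "{u, v} \<in> edges C \<longleftrightarrow> {?f u, ?f v} \<in> edges (P4 es)"
      by (simp add: ab P4_def set_es)
  next
    fix d e assume de: "d \<in> edges C" "e \<in> edges C"
    then obtain i j where ij: "i < 3" "j < 3" "d = ?g ` (es ! i)" "e = ?g ` (es ! j)"
      using length_es by (auto simp: C_def E in_set_conv_nth)
    have "(d, e) \<in> eord C \<longleftrightarrow> (d, e) \<in> eord ?F" using de by (simp add: C_def)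
    also have "\<dots> \<longleftrightarrow> 3 * k + i \<le> 3 * k + j"
      using eord_P4_copies_iff[of "3 * k + i" m "3 * k + j"] assms ij by (simp add: block)
    also have "\<dots> \<longleftrightarrow> (es ! i, es ! j) \<in> list_order es"
      using list_order_nth_iff[OF distinct_es] ij length_es by simp
    finally show "(d, e) \<in> eord C \<longleftrightarrow> (?f ` d, ?f ` e) \<in> eord (P4 es)"
      by (simp add: ij decode P4_def)
  qed
  ultimately show ?thesis by (intro exI[of _ C]) (simp add: eo_copy_def C_def E_def)
qed

text \<open>Either some copy is entirely blue, or every copy has a red edge. In the second case, one red
  edge from each copy gives \<open>m\<close> disjoint edges.\<close>

lemma P4_copies_arrows:
  assumes G: "is_mK2 m G"
  shows "eo_arrows (P4_copies m es) G (P4 es)"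
  unfolding eo_arrows_def
proof (intro allI)
  fix c :: "nat set \<Rightarrow> color"
  let ?F = "P4_copies m es"
  show "(\<exists>C. eo_copy C G ?F \<and> (\<forall>e\<in>edges C. c e = Red)) \<or>
    (\<exists>C. eo_copy C (P4 es) ?F \<and> (\<forall>e\<in>edges C. c e = Blue))"
  proof (cases "\<exists>k<m. \<forall>n\<in>{3 * k..<3 * k + 3}. c (P4_copies_edge es n) = Blue")
    case True
    then show ?thesis using P4_copies_contains_P4 by (metis imageE)
  next
    case False
    then have "\<exists>n. n div 3 = k \<and> c (P4_copies_edge es n) = Red" if k: "k < m" for k
    proof -
      obtain n where "n \<in> {3 * k..<3 * k + 3}" "c (P4_copies_edge es n) \<noteq> Blue"
        using False k by blast
      then show ?thesis by (intro exI[of _ n]) (auto intro: color.exhaust)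
    qed
    then obtain \<nu> where \<nu>: "\<And>k. k < m \<Longrightarrow> \<nu> k div 3 = k"
      "\<And>k. k < m \<Longrightarrow> c (P4_copies_edge es (\<nu> k)) = Red" by metis
    define M where "M = (\<lambda>k. P4_copies_edge es (\<nu> k)) ` {..<m}"
    define C where "C = \<lparr>verts = \<Union>M, edges = M, eord = Restr (eord ?F) M\<rparr>"
    have "\<nu> k < 3 * m" if "k < m" for k using \<nu>(1)[OF that] that by linarith
    then have "M \<subseteq> edges ?F" by (auto simp: M_def edges_P4_copies)
    then have sub: "eo_subgraph C ?F"
      unfolding C_def using edge_ordered_graph_P4_copies by (intro eo_subgraph_induced) auto
    have disj: "P4_copies_edge es (\<nu> k) \<inter> P4_copies_edge es (\<nu> l) = {}"
      if "k < m" "l < m" "k \<noteq> l" for k l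
      using P4_copies_edge_disjoint[of "\<nu> k" "\<nu> l"] \<nu>(1) that by simp
    have "inj_on (\<lambda>k. P4_copies_edge es (\<nu> k)) {..<m}"
      using \<nu>(1) inj_P4_copies_edge by (intro inj_onI) (metis injD lessThan_iff)
    then have "card M = m" by (simp add: M_def card_image)
    moreover have "pairwise disjnt M"
      unfolding pairwise_def disjnt_def M_def using disj by blast
    ultimately have "is_mK2 m C"
      using sub by (simp add: is_mK2_def eo_subgraph_def C_def)
    then have "eo_copy C G ?F" using matchings_isomorphic G sub by (auto simp: eo_copy_def)
    moreover have "\<forall>e\<in>edges C. c e = Red" using \<nu>(2) by (auto simp: C_def M_def)
    ultimately show ?thesis by blast
  qed
qed

section \<open>The Ramsey number\<close>

text \<open>Color red exactly the edges that meet the transversal \<open>X\<close>. No blue path remains, so there are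
  \<open>m\<close> disjoint red edges; they meet \<open>X\<close> in different vertices.\<close>

lemma matching_le_of_arrows:
  assumes F: "edge_ordered_graph F" and G: "is_mK2 m G" and arrows: "eo_arrows F G (P4 es)"
  shows "3 * m \<le> card (edges F)"
proof -
  have lin: "linear_order_on (edges F) (eord F)" and two: "\<forall>e\<in>edges F. card e = 2"
    and fin: "finite (edges F)"
    using F by (auto simp: edge_ordered_graph_def intro: finite_subset[of _ "Pow (verts F)"])
  \<comment> \<open>The middle edge of the pattern lies above or below its first edge; \<open>R\<close> is oriented so that the
    first edge comes first.\<close>
  define up where "up \<longleftrightarrow> (P4_edge 1, P4_edge 2) \<in> list_order es"
  define R where "R = (if up then eord F else (eord F)\<inverse>)"
  have "P4_edge 1 \<noteq> P4_edge 2" unfolding P4_edges by (simp add: doubleton_eq_iff)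
  then have down: "(P4_edge 2, P4_edge 1) \<in> list_order es" if "\<not> up"
    using that linear_order_on_list_order[OF distinct_es] set_es
    by (auto simp: up_def order_on_defs total_on_def)
  have "linear_order_on (edges F) R" using lin by (simp add: R_def)
  from path_transversal[OF fin two finite_linear_order_least[OF fin this]]
  obtain X where X: "finite X" "3 * card X \<le> card (edges F)"
    "\<not> has_path R (avoiding (edges F) X)" by blast
  define c where "c e = (if e \<inter> X = {} then Blue else Red)" for e
  have "\<not> (eo_copy C (P4 es) F \<and> (\<forall>e\<in>edges C. c e = Blue))" for C
  proof
    assume C: "eo_copy C (P4 es) F \<and> (\<forall>e\<in>edges C. c e = Blue)"
    then have sub: "edges C \<subseteq> avoiding (edges F) X"
      by (auto simp: eo_copy_def eo_subgraph_def avoiding_def c_def split: if_splits)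
    from C have "eo_copy C (P4 es) F" by blast
    then obtain p q r s where path: "distinct [p, q, r, s]"
      "{p, q} \<in> edges C" "{q, r} \<in> edges C" "{r, s} \<in> edges C"
      and ord: "up \<Longrightarrow> ({p, q}, {q, r}) \<in> eord F" "\<not> up \<Longrightarrow> ({q, r}, {p, q}) \<in> eord F"
      using down unfolding up_def by (elim P4_copy_path) blast
    have "({p, q}, {q, r}) \<in> R" using ord by (simp add: R_def)
    then have "has_path R (avoiding (edges F) X)"
      unfolding has_path_def using path sub by blast
    with X(3) show False by blast
  qed
  then obtain C where C: "eo_copy C G F" "\<forall>e\<in>edges C. c e = Red"
    using arrows unfolding eo_arrows_def by blast
  then have "edge_ordered_graph C" "eo_isomorphic C G"
    by (auto simp: eo_copy_def eo_subgraph_def)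
  note M = matching_of_isomorphic[OF G this]
  have "\<forall>e\<in>edges C. e \<inter> X \<noteq> {}" using C(2) by (auto simp: c_def split: if_splits)
  then have "m \<le> card X" using card_matching_le_transversal[OF X(1) M(2)] M(1) by simp
  with X(2) show ?thesis by linarith
qed

lemma size_eo_ramsey_matching_P4:
  assumes "is_mK2 m G"
  shows "size_eo_ramsey G (P4 es) = 3 * m"
  unfolding size_eo_ramsey_def
proof (rule cInf_eq_minimum)
  show "3 * m \<in> {card (edges F) |F :: nat eo_graph. edge_ordered_graph F \<and> eo_arrows F G (P4 es)}"
    unfolding mem_Collect_eq
    by (intro exI[of _ "P4_copies m es"] conjI edge_ordered_graph_P4_copies P4_copies_arrows[OF assms]
        card_edges_P4_copies[symmetric])
next
  fix n assume "n \<in> {card (edges F) |F :: nat eo_graph. edge_ordered_graph F \<and> eo_arrows F G (P4 es)}"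
  then show "3 * m \<le> n" using matching_le_of_arrows[OF _ assms] by blast
qed

end

theorem theorem3p1:
  fixes m :: nat and G :: "'a eo_graph" and P :: "nat eo_graph"
  assumes "m \<ge> 2"
    and "is_mK2 m G"
    and "P \<in> {P4_1, P4_2, P4_3}"
  shows "size_eo_ramsey G P = 3 * m"
proof -
  have "P4_edge 1 \<noteq> P4_edge 2" "P4_edge 1 \<noteq> P4_edge 3" "P4_edge 2 \<noteq> P4_edge 3"
    unfolding P4_edges by (simp_all add: doubleton_eq_iff)
  then obtain es where "distinct es" "set es = {P4_edge 1, P4_edge 2, P4_edge 3}" "P = P4 es"
    using assms(3) unfolding P4_1_def P4_2_def P4_3_def
    by (elim insertE emptyE) (rule that; auto)+
  then show ?thesis using size_eo_ramsey_matching_P4 assms(2) by blast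
qed

end
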